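(* Let $X$ be $c_0$ or $\ell^p$ with $1\le p<\infty$, let $B_w$ be a weighted backward shift on $X$ with weight sequence $w=(w_n)_{n\ge 1}$, and let $(n_k)_{k\ge 1}$ be an increasing sequence of positive integers. Then the following are equivalent. (i) $B_w$ is surjective and is ultra hypercyclic for $(n_k)_{k\ge 1}$. (ii) $B_w$ is surjective and, for all non-zero $x\in X$, $S^{n_k}x\to 0$ as $k\to\infty$. (iii) $\inf_{n\ge 1}w_n>0$, $\lim_{k\to\infty}M_1^{n_k}=\infty$, and $\inf_{i,k\ge 1}M_i^{n_k}>0$.
   Context: Here $c_0$ is the Banach space of complex sequences $x=(x_n)_{n\ge 0}$ with $x_n\to 0$, with norm $\|x\|=\sup_n|x_n|$, and $\ell^p$ is the Banach space of complex sequences $(x_n)_{n\ge 0}$ with $\|x\|=(\sum_{n\ge 0}|x_n|^p)^{1/p}<\infty$. Let $e_n$, $n\ge 0$, be the canonical basis vectors. A weighted backward shift $B_w$ on $X$ is given by a bounded sequence $w=(w_n)_{n\ge 1}$ of positive numbers: it is the continuous linear operator with $B_we_0=0$ and $B_we_n=w_ne_{n-1}$ for $n\ge 1$, i.e. $B_w(x_0,x_1,x_2,\dots)=(w_1x_1,w_2x_2,\dots)$. It is surjective on $X$ if and only if $\inf_n w_n>0$. In that case $S$ denotes the associated weighted forward shift on $X$, the continuous linear operator with $Se_n=e_{n+1}/w_{n+1}$ for $n\ge 0$; it satisfies $B_wS=I$. For $i,j\ge 1$, $M_i^j=w_iw_{i+1}\cdots w_{i+j-1}$ (product of $j$ consecutive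 weights starting at $w_i$). A continuous linear operator $T$ on $X$ is ultra hypercyclic for an increasing sequence $(n_k)_{k\ge 1}$ of positive integers if, for each non-empty open subset $U$ of $X$, $X=\bigcup_{i\ge 1}\bigcap_{k\ge i}T^{n_k}(U)$. "Increasing" means strictly increasing. *)

theory Defs
  imports "HOL-Analysis.Analysis"
begin

section \<open>The sequence spaces\<close>

definition c0_space :: "(nat \<Rightarrow> complex) set" where
  "c0_space = {x. x \<longlonglongrightarrow> 0}"

definition c0_norm :: "(nat \<Rightarrow> complex) \<Rightarrow> real" where
  "c0_norm x = (SUP n. norm (x n))"

definition lp_space :: "real \<Rightarrow> (nat \<Rightarrow> complex) set" where
  "lp_space p = {x. summable (\<lambda>n. norm (x n) powr p)}"

definition lp_norm :: "real \<Rightarrow> (nat \<Rightarrow> complex) \<Rightarrow> real" where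
  "lp_norm p x = (\<Sum>n. norm (x n) powr p) powr (1 / p)"

definition c0_or_lp :: "(nat \<Rightarrow> complex) set \<Rightarrow> ((nat \<Rightarrow> complex) \<Rightarrow> real) \<Rightarrow> bool" where
  "c0_or_lp X N \<longleftrightarrow> X = c0_space \<and> N = c0_norm \<or> (\<exists>p\<ge>1. X = lp_space p \<and> N = lp_norm p)"

text \<open>The value outside \<open>X\<close> is irrelevant; it is 0 because \<^locale>\<open>Metric_space\<close> requires
  nonnegativity and symmetry everywhere.  That this is a metric on the spaces above is
  \<open>c0_or_lp_metric\<close> below.\<close>

definition norm_dist ::
    "(nat \<Rightarrow> complex) set \<Rightarrow> ((nat \<Rightarrow> complex) \<Rightarrow> real) \<Rightarrow>
      (nat \<Rightarrow> complex) \<Rightarrow> (nat \<Rightarrow> complex) \<Rightarrow> real" where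
  "norm_dist X N x y = (if x \<in> X \<and> y \<in> X then N (\<lambda>n. x n - y n) else 0)"

definition norm_topology ::
    "(nat \<Rightarrow> complex) set \<Rightarrow> ((nat \<Rightarrow> complex) \<Rightarrow> real) \<Rightarrow> (nat \<Rightarrow> complex) topology" where
  "norm_topology X N = Metric_space.mtopology X (norm_dist X N)"

definition basis_vec :: "nat \<Rightarrow> nat \<Rightarrow> complex" where
  "basis_vec n = (\<lambda>m. if m = n then 1 else 0)"


section \<open>Operators\<close>

definition continuous_linear_operator ::
    "(nat \<Rightarrow> complex) set \<Rightarrow> ((nat \<Rightarrow> complex) \<Rightarrow> real) \<Rightarrow>
      ((nat \<Rightarrow> complex) \<Rightarrow> (nat \<Rightarrow> complex)) \<Rightarrow> bool" where
  "continuous_linear_operator X N T \<longleftrightarrow>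
     continuous_map (norm_topology X N) (norm_topology X N) T \<and>
     (\<forall>x\<in>X. \<forall>y\<in>X. T (\<lambda>n. x n + y n) = (\<lambda>n. T x n + T y n)) \<and>
     (\<forall>c. \<forall>x\<in>X. T (\<lambda>n. c * x n) = (\<lambda>n. c * T x n))"

text \<open>Weights and the sequence \<open>n\<^sub>k\<close> are indexed from 1; their values at 0 do not matter.\<close>

definition ultra_hypercyclic ::
    "(nat \<Rightarrow> complex) set \<Rightarrow> ((nat \<Rightarrow> complex) \<Rightarrow> real) \<Rightarrow>
      ((nat \<Rightarrow> complex) \<Rightarrow> (nat \<Rightarrow> complex)) \<Rightarrow> (nat \<Rightarrow> nat) \<Rightarrow> bool" where
  "ultra_hypercyclic X N T n \<longleftrightarrow>
     continuous_linear_operator X N T \<and>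
     (\<forall>U. openin (norm_topology X N) U \<and> U \<noteq> {} \<longrightarrow>
        X = (\<Union>i\<in>{1..}. \<Inter>k\<in>{i..}. (T ^^ n k) ` U))"

definition backward_shift :: "(nat \<Rightarrow> real) \<Rightarrow> (nat \<Rightarrow> complex) \<Rightarrow> nat \<Rightarrow> complex" where
  "backward_shift w x = (\<lambda>m. of_real (w (Suc m)) * x (Suc m))"

text \<open>In coordinates, \<open>S (x\<^sub>0, x\<^sub>1, \<dots>) = (0, x\<^sub>0 / w\<^sub>1, x\<^sub>1 / w\<^sub>2, \<dots>)\<close>. The lemmas
  \<open>forward_shift_basis_vec\<close> and \<open>forward_shift_continuous_linear\<close> below show that, if the weights are
  bounded away from 0, this is a continuous linear operator with
  \<open>S e\<^sub>n = e\<^sub>n\<^sub>+\<^sub>1 / w\<^sub>n\<^sub>+\<^sub>1\<close>.\<close>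

definition forward_shift :: "(nat \<Rightarrow> real) \<Rightarrow> (nat \<Rightarrow> complex) \<Rightarrow> nat \<Rightarrow> complex" where
  "forward_shift w x = (\<lambda>m. case m of 0 \<Rightarrow> 0 | Suc j \<Rightarrow> x j / of_real (w (Suc j)))"

definition weight_prod :: "(nat \<Rightarrow> real) \<Rightarrow> nat \<Rightarrow> nat \<Rightarrow> real" where
  "weight_prod w i j = (\<Prod>l\<in>{i..<i + j}. w l)"


section \<open>Well-definedness\<close>

lemma backward_shift_basis_vec_0: "backward_shift w (basis_vec 0) = (\<lambda>_. 0)"
  by (simp add: backward_shift_def basis_vec_def)

lemma backward_shift_basis_vec:
  "n \<ge> 1 \<Longrightarrow> backward_shift w (basis_vec n) = (\<lambda>m. of_real (w n) * basis_vec (n - 1) m)"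
  by (auto simp: backward_shift_def basis_vec_def fun_eq_iff)

lemma forward_shift_basis_vec:
  "forward_shift w (basis_vec n) = (\<lambda>m. basis_vec (Suc n) m / of_real (w (Suc n)))"
  by (auto simp: forward_shift_def basis_vec_def fun_eq_iff split: nat.split)

lemma backward_forward_shift:
  assumes "\<And>n. n \<ge> 1 \<Longrightarrow> w n > 0"
  shows "backward_shift w (forward_shift w x) = x"
proof
  show "backward_shift w (forward_shift w x) m = x m" for m
    using assms[of "Suc m"] by (simp add: backward_shift_def forward_shift_def)
qed

lemma c0_bdd: "x \<in> c0_space \<Longrightarrow> bdd_above (range (\<lambda>n. norm (x n)))"
  using Bseq_eq_bounded[of x] convergent_imp_Bseq[OF convergentI[of x 0]]
  by (simp add: c0_space_def bdd_above_norm[symmetric] image_image)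

lemma c0_norm_upper: "x \<in> c0_space \<Longrightarrow> norm (x n) \<le> c0_norm x"
  unfolding c0_norm_def using c0_bdd by (intro cSUP_upper) auto

lemma c0_norm_least: "(\<And>n. norm (x n) \<le> C) \<Longrightarrow> c0_norm x \<le> C"
  unfolding c0_norm_def by (intro cSUP_least) auto

lemma powr_convex_nonneg:
  fixes a b t p :: real
  assumes "p \<ge> 1" "a \<ge> 0" "b \<ge> 0" "0 < t" "t < 1"
  shows "((1 - t) * a + t * b) powr p \<le> (1 - t) * a powr p + t * b powr p"
proof -
  have small: "s powr p \<le> s" if "0 < s" "s < 1" for s :: real
    using powr_mono'[of 1 p s] that assms by simp
  consider "a = 0" | "b = 0" | "a > 0" "b > 0" using assms by linarith
  then show ?thesis
  proof cases
    case 1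
    have "t powr p * b powr p \<le> t * b powr p"
      using small[of t] assms by (intro mult_right_mono) auto
    then show ?thesis using 1 assms by (simp add: powr_mult)
  next
    case 2
    have "(1 - t) powr p * a powr p \<le> (1 - t) * a powr p"
      using small[of "1 - t"] assms by (intro mult_right_mono) auto
    then show ?thesis using 2 assms by (simp add: powr_mult)
  next
    case 3
    then show ?thesis
      using convex_onD[OF powr_convex[OF assms(1)], of t a b] assms by simp
  qed
qed

lemma lp_norm_nonneg: "lp_norm p x \<ge> 0"
  by (simp add: lp_norm_def)

lemma lp_norm_powr:
  assumes "p \<ge> 1" "x \<in> lp_space p"
  shows "lp_norm p x powr p = (\<Sum>n. norm (x n) powr p)"
proof -
  have "(\<Sum>n. norm (x n) powr p) \<ge> 0"
    using assms by (intro suminf_nonneg) (auto simp: lp_space_def)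
  then show ?thesis using assms by (simp add: lp_norm_def powr_powr)
qed

lemma lp_norm_eq_0:
  assumes "p \<ge> 1" "x \<in> lp_space p"
  shows "lp_norm p x = 0 \<longleftrightarrow> x = (\<lambda>_. 0)"
proof -
  have "lp_norm p x = 0 \<longleftrightarrow> (\<Sum>n. norm (x n) powr p) = 0"
    by (simp add: lp_norm_def)
  also have "\<dots> \<longleftrightarrow> (\<forall>n. norm (x n) powr p = 0)"
    using assms by (intro suminf_eq_zero_iff) (auto simp: lp_space_def)
  finally show ?thesis by (auto simp: fun_eq_iff)
qed

lemma lp_norm_le:
  assumes "p \<ge> 1" "C \<ge> 0" "(\<Sum>n. norm (x n) powr p) \<le> C powr p" "x \<in> lp_space p"
  shows "lp_norm p x \<le> C"
proof -
  have "lp_norm p x \<le> (C powr p) powr (1 / p)"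
    unfolding lp_norm_def using assms
    by (intro powr_mono2 suminf_nonneg) (auto simp: lp_space_def)
  then show ?thesis using assms by (simp add: powr_powr)
qed

lemma lp_dominated:
  assumes p: "p \<ge> 1" and C: "C \<ge> 0" and x: "x \<in> lp_space p"
    and y: "\<And>n. norm (y n) \<le> C * norm (x n)"
  shows "y \<in> lp_space p" "lp_norm p y \<le> C * lp_norm p x"
proof -
  have le: "norm (y n) powr p \<le> C powr p * norm (x n) powr p" for n
    using powr_mono2[of p "norm (y n)" "C * norm (x n)"] y[of n] p C by (simp add: powr_mult)
  have sx: "summable (\<lambda>n. C powr p * norm (x n) powr p)"
    using x by (intro summable_mult) (simp add: lp_space_def)
  show y': "y \<in> lp_space p"
    unfolding lp_space_def mem_Collect_eq using le by (intro summable_comparison_test'[OF sx]) auto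
  have "(\<Sum>n. norm (y n) powr p) \<le> (\<Sum>n. C powr p * norm (x n) powr p)"
    using le sx y' by (intro suminf_le) (auto simp: lp_space_def)
  also have "\<dots> = (C * lp_norm p x) powr p"
    using x C lp_norm_nonneg[of p x] lp_norm_powr[OF p x]
    by (simp add: suminf_mult lp_space_def powr_mult)
  finally show "lp_norm p y \<le> C * lp_norm p x"
    using p C lp_norm_nonneg y' by (intro lp_norm_le) auto
qed

lemma lp_triangle:
  assumes p: "p \<ge> 1" and x: "x \<in> lp_space p" and y: "y \<in> lp_space p"
  shows "(\<lambda>n. x n + y n) \<in> lp_space p \<and> lp_norm p (\<lambda>n. x n + y n) \<le> lp_norm p x + lp_norm p y"
proof -
  define a where "a = lp_norm p x"
  define b where "b = lp_norm p y"
  have nn: "a \<ge> 0" "b \<ge> 0" by (simp_all add: a_def b_def lp_norm_nonneg)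
  consider "a = 0" | "b = 0" | "a > 0" "b > 0" using nn by linarith
  then show ?thesis
  proof cases
    case 1
    then have "x = (\<lambda>_. 0)" using lp_norm_eq_0[OF p x] a_def by simp
    then show ?thesis using y lp_norm_nonneg[of p x] by simp
  next
    case 2
    then have "y = (\<lambda>_. 0)" using lp_norm_eq_0[OF p y] b_def by simp
    then show ?thesis using x lp_norm_nonneg[of p y] by simp
  next
    case 3
    define t where "t = b / (a + b)"
    have t: "0 < t" "t < 1" "1 - t = a / (a + b)" using 3 by (auto simp: t_def field_simps)
    let ?F = "\<lambda>n. (a + b) powr p *
      ((1 - t) * (norm (x n) powr p / a powr p) + t * (norm (y n) powr p / b powr p))"
    have le: "norm (x n + y n) powr p \<le> ?F n" for n
    proof -
      have "norm (x n + y n) \<le> norm (x n) + norm (y n)" by (rule norm_triangle_ineq)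
      also have "\<dots> = (a + b) * ((1 - t) * (norm (x n) / a) + t * (norm (y n) / b))"
        unfolding t(3) unfolding t_def using 3 by (simp add: distrib_left)
      finally have "norm (x n + y n) powr p \<le>
          ((a + b) * ((1 - t) * (norm (x n) / a) + t * (norm (y n) / b))) powr p"
        using p by (intro powr_mono2) auto
      also have "\<dots> = (a + b) powr p * ((1 - t) * (norm (x n) / a) + t * (norm (y n) / b)) powr p"
        using 3 t(1,2) by (intro powr_mult)
      also have "\<dots> \<le> (a + b) powr p *
          ((1 - t) * (norm (x n) / a) powr p + t * (norm (y n) / b) powr p)"
        using 3 t p by (intro mult_left_mono powr_convex_nonneg) auto
      finally show ?thesis using 3 by (simp add: powr_divide)
    qed
    have ap: "(\<lambda>n. norm (x n) powr p) sums (a powr p)" "(\<lambda>n. norm (y n) powr p) sums (b powr p)"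
      using x y lp_norm_powr[OF p x] lp_norm_powr[OF p y]
      by (auto simp: lp_space_def a_def b_def summable_sums)
    have "?F sums ((a + b) powr p *
        ((1 - t) * (a powr p / a powr p) + t * (b powr p / b powr p)))"
      by (intro sums_mult sums_add sums_divide ap)
    then have F: "?F sums ((a + b) powr p)" using 3 by simp
    have mem: "(\<lambda>n. x n + y n) \<in> lp_space p"
      unfolding lp_space_def mem_Collect_eq
      using le by (intro summable_comparison_test'[OF sums_summable[OF F]]) auto
    have "(\<Sum>n. norm (x n + y n) powr p) \<le> (\<Sum>n. ?F n)"
      using le sums_summable[OF F] mem by (intro suminf_le) (auto simp: lp_space_def)
    then have "(\<Sum>n. norm (x n + y n) powr p) \<le> (a + b) powr p"
      using sums_unique[OF F] by simp
    then show ?thesis using lp_norm_le[OF p _ _ mem, of "a + b"] mem nn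
      by (simp add: a_def b_def)
  qed
qed

lemma c0_or_lp_cases:
  assumes "c0_or_lp X N" "P c0_space c0_norm" "\<And>p. p \<ge> 1 \<Longrightarrow> P (lp_space p) (lp_norm p)"
  shows "P X N"
  using assms(1) unfolding c0_or_lp_def by (elim disjE conjE exE) (simp_all add: assms(2,3))

lemma c0_or_lp_triangle:
  assumes "c0_or_lp X N" "x \<in> X" "y \<in> X"
  shows "(\<lambda>n. x n + y n) \<in> X" "N (\<lambda>n. x n + y n) \<le> N x + N y"
proof -
  have c0: "(\<lambda>n. x n + y n) \<in> c0_space \<and> c0_norm (\<lambda>n. x n + y n) \<le> c0_norm x + c0_norm y"
    if "x \<in> c0_space" "y \<in> c0_space"
  proof (intro conjI c0_norm_least)
    show "(\<lambda>n. x n + y n) \<in> c0_space"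
      using that tendsto_add[of x 0 sequentially y 0] by (simp add: c0_space_def)
    show "norm (x n + y n) \<le> c0_norm x + c0_norm y" for n
      using norm_triangle_ineq[of "x n" "y n"] c0_norm_upper[of x n] c0_norm_upper[of y n] that
      by linarith
  qed
  have "x \<in> X \<and> y \<in> X \<longrightarrow> (\<lambda>n. x n + y n) \<in> X \<and> N (\<lambda>n. x n + y n) \<le> N x + N y"
    using assms(1) by (rule c0_or_lp_cases) (use c0 lp_triangle in blast)+
  then show "(\<lambda>n. x n + y n) \<in> X" "N (\<lambda>n. x n + y n) \<le> N x + N y"
    using assms(2,3) by blast+
qed

lemma c0_or_lp_dominated:
  assumes "c0_or_lp X N" "C \<ge> 0" "x \<in> X" "\<And>n. norm (y n) \<le> C * norm (x n)"
  shows "y \<in> X" "N y \<le> C * N x"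
proof -
  have c0: "y \<in> c0_space \<and> c0_norm y \<le> C * c0_norm x" if "x \<in> c0_space"
  proof (intro conjI c0_norm_least)
    have "(\<lambda>n. C * norm (x n)) \<longlonglongrightarrow> 0"
      using that unfolding c0_space_def by (intro tendsto_mult_right_zero tendsto_norm_zero) simp
    then show "y \<in> c0_space"
      unfolding c0_space_def mem_Collect_eq
      by (rule Lim_null_comparison[rotated]) (use assms(4) in auto)
    show "norm (y n) \<le> C * c0_norm x" for n
      using assms(4)[of n] mult_left_mono[OF c0_norm_upper[OF that, of n] assms(2)] by linarith
  qed
  have "x \<in> X \<longrightarrow> y \<in> X \<and> N y \<le> C * N x"
    using assms(1)
  proof (rule c0_or_lp_cases)
    show "x \<in> lp_space p \<longrightarrow> y \<in> lp_space p \<and> lp_norm p y \<le> C * lp_norm p x" if "p \<ge> 1" for p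
      by (intro impI conjI lp_dominated[OF that assms(2) _ assms(4)])
  qed (use c0 in blast)
  then show "y \<in> X" "N y \<le> C * N x"
    using assms(3) by blast+
qed

lemma c0_or_lp_eq_0:
  assumes "c0_or_lp X N" "x \<in> X"
  shows "N x \<ge> 0" "N x = 0 \<longleftrightarrow> x = (\<lambda>_. 0)"
proof -
  have c0: "c0_norm x \<ge> 0 \<and> (c0_norm x = 0 \<longleftrightarrow> x = (\<lambda>_. 0))" if "x \<in> c0_space"
  proof -
    have "norm (x n) \<le> c0_norm x" for n using c0_norm_upper that by auto
    then have "c0_norm x \<ge> 0" "c0_norm x = 0 \<Longrightarrow> x = (\<lambda>_. 0)"
      using order_trans[OF norm_ge_zero] by (blast, simp add: fun_eq_iff)
    moreover have "c0_norm (\<lambda>_. 0) = 0" by (simp add: c0_norm_def)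
    ultimately show ?thesis by blast
  qed
  have "x \<in> X \<longrightarrow> N x \<ge> 0 \<and> (N x = 0 \<longleftrightarrow> x = (\<lambda>_. 0))"
    using assms(1) by (rule c0_or_lp_cases) (use c0 lp_norm_nonneg lp_norm_eq_0 in blast)+
  then show "N x \<ge> 0" "N x = 0 \<longleftrightarrow> x = (\<lambda>_. 0)"
    using assms(2) by blast+
qed

lemma c0_or_lp_diff:
  assumes "c0_or_lp X N" "x \<in> X" "y \<in> X"
  shows "(\<lambda>n. x n - y n) \<in> X"
  using c0_or_lp_triangle(1)[OF assms(1,2) c0_or_lp_dominated(1)[OF assms(1) _ assms(3),
    of 1 "\<lambda>n. - y n"]] by simp

lemma c0_or_lp_metric:
  assumes "c0_or_lp X N"
  shows "Metric_space X (norm_dist X N)"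
proof
  show "norm_dist X N x y \<ge> 0" for x y
    using c0_or_lp_eq_0(1)[OF assms c0_or_lp_diff[OF assms]] by (auto simp: norm_dist_def)
  have "N (\<lambda>n. x n - y n) \<le> N (\<lambda>n. y n - x n)" if "x \<in> X" "y \<in> X" for x y
    using c0_or_lp_dominated(2)[OF assms _ c0_or_lp_diff[OF assms that(2,1)], of 1 "\<lambda>n. x n - y n"]
    by (simp add: norm_minus_commute)
  then show "norm_dist X N x y = norm_dist X N y x" for x y
    by (auto simp: norm_dist_def intro!: antisym)
  show "norm_dist X N x y = 0 \<longleftrightarrow> x = y" if "x \<in> X" "y \<in> X" for x y
    using c0_or_lp_eq_0(2)[OF assms c0_or_lp_diff[OF assms that]] that
    by (simp add: norm_dist_def fun_eq_iff)
  show "norm_dist X N x z \<le> norm_dist X N x y + norm_dist X N y z"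
    if "x \<in> X" "y \<in> X" "z \<in> X" for x y z
    using c0_or_lp_triangle(2)[OF assms c0_or_lp_diff[OF assms that(1,2)]
        c0_or_lp_diff[OF assms that(2,3)]] that
    by (simp add: norm_dist_def)
qed

lemma bounded_continuous_map:
  assumes X: "c0_or_lp X N" and C: "C \<ge> 0"
    and T: "\<And>x. x \<in> X \<Longrightarrow> T x \<in> X" "\<And>x. x \<in> X \<Longrightarrow> N (T x) \<le> C * N x"
    and diff: "\<And>x y. T (\<lambda>n. x n - y n) = (\<lambda>n. T x n - T y n)"
  shows "continuous_map (norm_topology X N) (norm_topology X N) T"
proof -
  interpret Metric_space X "norm_dist X N" by (rule c0_or_lp_metric[OF X])
  have lip: "norm_dist X N (T x) (T y) \<le> C * norm_dist X N x y" if "x \<in> X" "y \<in> X" for x y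
    using T(2)[OF c0_or_lp_diff[OF X that]] that T(1) by (simp add: norm_dist_def diff)
  show ?thesis
    unfolding norm_topology_def continuous_map_to_metric
  proof (intro ballI allI impI)
    fix x and e :: real
    assume x: "x \<in> topspace mtopology" and e: "e > 0"
    show "\<exists>U. openin mtopology U \<and> x \<in> U \<and> (\<forall>y\<in>U. T y \<in> mball (T x) e)"
    proof (intro exI conjI ballI)
      show "openin mtopology (mball x (e / (C + 1)))" by simp
      show "x \<in> mball x (e / (C + 1))" using x e C by simp
      fix y assume y: "y \<in> mball x (e / (C + 1))"
      then have "C * norm_dist X N x y \<le> C * (e / (C + 1))"
        using C by (intro mult_left_mono) auto
      also have "\<dots> < e" using e C by (simp add: field_simps)
      finally show "T y \<in> mball (T x) e"
        using lip[of x y] T(1) x y by auto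
    qed
  qed
qed

lemma shift_left:
  assumes "c0_or_lp X N" "x \<in> X"
  shows "(\<lambda>n. x (Suc n)) \<in> X" "N (\<lambda>n. x (Suc n)) \<le> N x"
proof -
  have c0: "(\<lambda>n. x (Suc n)) \<in> c0_space \<and> c0_norm (\<lambda>n. x (Suc n)) \<le> c0_norm x" if "x \<in> c0_space"
  proof (intro conjI c0_norm_least)
    show "(\<lambda>n. x (Suc n)) \<in> c0_space" using that by (auto simp: c0_space_def intro: LIMSEQ_Suc)
    show "norm (x (Suc n)) \<le> c0_norm x" for n using that by (rule c0_norm_upper)
  qed
  have lp: "(\<lambda>n. x (Suc n)) \<in> lp_space p \<and> lp_norm p (\<lambda>n. x (Suc n)) \<le> lp_norm p x"
    if p: "p \<ge> 1" and x: "x \<in> lp_space p" for p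
  proof -
    have s: "summable (\<lambda>n. norm (x n) powr p)" using x by (simp add: lp_space_def)
    then have m: "(\<lambda>n. x (Suc n)) \<in> lp_space p"
      unfolding lp_space_def mem_Collect_eq by (subst summable_Suc_iff)
    have "(\<Sum>n. norm (x (Suc n)) powr p) \<le> lp_norm p x powr p"
      using suminf_split_head[OF s] lp_norm_powr[OF that] by simp
    then show ?thesis using m lp_norm_le[OF p lp_norm_nonneg _ m] by blast
  qed
  have "x \<in> X \<longrightarrow> (\<lambda>n. x (Suc n)) \<in> X \<and> N (\<lambda>n. x (Suc n)) \<le> N x"
    using assms(1) by (rule c0_or_lp_cases) (use c0 lp in blast)+
  then show "(\<lambda>n. x (Suc n)) \<in> X" "N (\<lambda>n. x (Suc n)) \<le> N x"
    using assms(2) by blast+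
qed

lemma shift_right:
  assumes "c0_or_lp X N" "x \<in> X"
  shows "case_nat 0 x \<in> X" "N (case_nat 0 x) \<le> N x"
proof -
  have c0: "case_nat 0 x \<in> c0_space \<and> c0_norm (case_nat 0 x) \<le> c0_norm x" if "x \<in> c0_space"
  proof (intro conjI c0_norm_least)
    have "(\<lambda>n. case_nat 0 x (Suc n)) \<longlonglongrightarrow> 0" using that by (simp add: c0_space_def)
    then show "case_nat 0 x \<in> c0_space" unfolding c0_space_def mem_Collect_eq by (rule LIMSEQ_imp_Suc)
    show "norm (case_nat 0 x n) \<le> c0_norm x" for n
      using c0_norm_upper[OF that] order_trans[OF norm_ge_zero c0_norm_upper[OF that]]
      by (auto split: nat.split)
  qed
  have lp: "case_nat 0 x \<in> lp_space p \<and> lp_norm p (case_nat 0 x) \<le> lp_norm p x"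
    if p: "p \<ge> 1" and x: "x \<in> lp_space p" for p
  proof -
    have "summable (\<lambda>n. norm (case_nat 0 x (Suc n)) powr p)" using x by (simp add: lp_space_def)
    then have s: "summable (\<lambda>n. norm (case_nat 0 x n) powr p)" by (subst (asm) summable_Suc_iff)
    then have m: "case_nat 0 x \<in> lp_space p" by (simp add: lp_space_def)
    have "(\<Sum>n. norm (case_nat 0 x n) powr p) \<le> lp_norm p x powr p"
      using suminf_split_head[OF s] lp_norm_powr[OF that] by simp
    then show ?thesis using m lp_norm_le[OF p lp_norm_nonneg _ m] by blast
  qed
  have "x \<in> X \<longrightarrow> case_nat 0 x \<in> X \<and> N (case_nat 0 x) \<le> N x"
    using assms(1) by (rule c0_or_lp_cases) (use c0 lp in blast)+
  then show "case_nat 0 x \<in> X" "N (case_nat 0 x) \<le> N x"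
    using assms(2) by blast+
qed

lemma backward_shift_continuous_linear:
  assumes X: "c0_or_lp X N" and w: "\<And>n. n \<ge> 1 \<Longrightarrow> w n > 0" "bounded (w ` {1..})"
  shows "continuous_linear_operator X N (backward_shift w)"
proof -
  obtain C where C: "\<And>n. n \<ge> 1 \<Longrightarrow> \<bar>w n\<bar> \<le> C"
    using w(2) by (auto simp: bounded_iff)
  then have C0: "C \<ge> 0" using order_trans[OF abs_ge_zero C[of 1]] by simp
  have dom: "norm (backward_shift w x n) \<le> C * norm (x (Suc n))" for x n
    using C[of "Suc n"] by (auto simp: backward_shift_def norm_mult intro!: mult_right_mono)
  have mem: "backward_shift w x \<in> X" if "x \<in> X" for x
    using c0_or_lp_dominated(1)[OF X C0 shift_left(1)[OF X that] dom[of x]] .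
  have le: "N (backward_shift w x) \<le> C * N x" if "x \<in> X" for x
    using c0_or_lp_dominated(2)[OF X C0 shift_left(1)[OF X that] dom[of x]]
      mult_left_mono[OF shift_left(2)[OF X that] C0] by (rule order_trans)
  have "continuous_map (norm_topology X N) (norm_topology X N) (backward_shift w)"
    by (rule bounded_continuous_map[OF X C0 mem le]) (auto simp: backward_shift_def algebra_simps)
  then show ?thesis
    by (auto simp: continuous_linear_operator_def backward_shift_def algebra_simps)
qed

lemma forward_shift_continuous_linear:
  assumes X: "c0_or_lp X N" and w: "\<And>n. n \<ge> 1 \<Longrightarrow> w n > 0" "(INF n\<in>{1..}. w n) > 0"
  shows "continuous_linear_operator X N (forward_shift w)"
proof -
  define d where "d = (INF n\<in>{1..}. w n)"
  have d: "d > 0" using w(2) by (simp add: d_def)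
  have "bdd_below (w ` {1..})" using w(1) by (intro bdd_belowI2[of _ 0]) (simp add: less_imp_le)
  then have wd: "w n \<ge> d" if "n \<ge> 1" for n
    unfolding d_def using that by (intro cINF_lower) auto
  have C0: "1 / d \<ge> 0" using d by simp
  have dom: "norm (forward_shift w x n) \<le> 1 / d * norm (case_nat 0 x n)" for x n
  proof (cases n)
    case (Suc j)
    have "norm (x j) / w (Suc j) \<le> norm (x j) / d"
      using wd[of "Suc j"] d by (intro divide_left_mono) auto
    then show ?thesis using Suc w(1)[of "Suc j"] by (simp add: forward_shift_def norm_divide)
  qed (simp add: forward_shift_def)
  have mem: "forward_shift w x \<in> X" if "x \<in> X" for x
    using c0_or_lp_dominated(1)[OF X C0 shift_right(1)[OF X that] dom[of x]] .
  have le: "N (forward_shift w x) \<le> 1 / d * N x" if "x \<in> X" for x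
    using c0_or_lp_dominated(2)[OF X C0 shift_right(1)[OF X that] dom[of x]]
      mult_left_mono[OF shift_right(2)[OF X that] C0] by (rule order_trans)
  have "continuous_map (norm_topology X N) (norm_topology X N) (forward_shift w)"
    by (rule bounded_continuous_map[OF X C0 mem le])
      (auto simp: forward_shift_def diff_divide_distrib fun_eq_iff split: nat.split)
  then show ?thesis
    by (auto simp: continuous_linear_operator_def forward_shift_def add_divide_distrib fun_eq_iff
        split: nat.split)
qed

end

theory Submission
  imports Defs
begin

text \<open>
  Every solution \<open>y\<close> of \<open>B\<^sub>w\<^sup>m y = x\<close> agrees with \<open>S\<^sup>m x\<close> from coordinate \<open>m\<close> on and is arbitrary before
  that, so \<open>S\<^sup>m x\<close> is the solution of smallest norm. Hence a ball around 0 meets the preimage of \<open>x\<close>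
  exactly when \<open>S\<^sup>m x\<close> lies in it, which turns ultra hypercyclicity into \<open>S\<^bsup>n k\<^esup> x \<rightarrow> 0\<close>. Balls around
  any other point \<open>u\<close> come for free, since the first \<open>n k\<close> coordinates of \<open>u\<close>, which already
  approximate \<open>u\<close>, can be put in front of \<open>S\<^bsup>n k\<^esup> x\<close> (\<open>ultra_hypercyclic_iff\<close>).

  As \<open>S\<^sup>m\<close> sends \<open>e\<^sub>i\<close> to \<open>e\<^bsub>i+m\<^esub> / M\<^bsub>i+1\<^esub>\<^sup>m\<close>, pointwise convergence of the powers \<open>S\<^bsup>n k\<^esup>\<close> to 0 means
  convergence on the basis together with uniform boundedness of the factors \<open>1 / M\<^bsub>i+1\<^esub>\<^bsup>n k\<^esup>\<close>.
  Uniform boundedness follows from pointwise boundedness by a gliding hump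
  (\<open>bounded_multiplier\<close>), which also shows that surjectivity of \<open>B\<^sub>w\<close> forces \<open>inf w > 0\<close>. Convergence
  on the single vector \<open>e\<^sub>0\<close> is enough, because
  \<open>M\<^sub>1\<^sup>i M\<^bsub>i+1\<^esub>\<^sup>m = M\<^sub>1\<^sup>m M\<^bsub>m+1\<^esub>\<^sup>i\<close> and \<open>M\<^bsub>m+1\<^esub>\<^sup>i\<close> is at least \<open>(inf w)\<^sup>i\<close>.
\<close>

section \<open>Coordinates, tails and right shifts in the sequence spaces\<close>

lemma zero_mem_c0_or_lp: "c0_or_lp X N \<Longrightarrow> (\<lambda>_. 0) \<in> X"
  by (erule c0_or_lp_cases) (simp_all add: c0_space_def lp_space_def)

lemma coordinate_le_norm:
  assumes "c0_or_lp X N" "x \<in> X"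
  shows "norm (x i) \<le> N x"
proof -
  have lp: "norm (x i) \<le> lp_norm p x" if p: "p \<ge> 1" and x: "x \<in> lp_space p" for p
  proof (rule ccontr)
    assume "\<not> ?thesis"
    then have "lp_norm p x powr p < norm (x i) powr p"
      using p lp_norm_nonneg[of p x] by (intro powr_less_mono2) auto
    moreover have "norm (x i) powr p \<le> (\<Sum>n. norm (x n) powr p)"
      using x sum_le_suminf[of "\<lambda>n. norm (x n) powr p" "{i}"] by (simp add: lp_space_def)
    ultimately show False using lp_norm_powr[OF p x] by simp
  qed
  have "x \<in> X \<longrightarrow> norm (x i) \<le> N x"
    using assms(1) by (rule c0_or_lp_cases) (use c0_norm_upper lp in blast)+
  then show ?thesis using assms(2) by blast
qed

lemma absolutely_summable_mem_c0_or_lp: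
  assumes X: "c0_or_lp X N" and x: "summable (\<lambda>n. norm (x n))"
  shows "x \<in> X"
proof -
  have lim: "(\<lambda>n. norm (x n)) \<longlonglongrightarrow> 0" by (rule summable_LIMSEQ_zero[OF x])
  have lp: "x \<in> lp_space p" if p: "p \<ge> 1" for p
  proof -
    have "\<forall>\<^sub>F n in sequentially. norm (x n) < 1"
      using order_tendstoD(2)[OF lim, of 1] by simp
    then have "\<forall>\<^sub>F n in sequentially. norm (norm (x n) powr p) \<le> norm (x n)"
    proof eventually_elim
      case (elim n)
      then show ?case
        using powr_mono'[of 1 p "norm (x n)"] p by (cases "x n = 0") auto
    qed
    then show ?thesis
      unfolding lp_space_def mem_Collect_eq by (rule summable_comparison_test_ev[OF _ x])
  qed
  show ?thesis
    using X by (rule c0_or_lp_cases) (use lim lp tendsto_norm_zero_cancel in \<open>auto simp: c0_space_def\<close>)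
qed

lemma basis_vec_mem_c0_or_lp: "c0_or_lp X N \<Longrightarrow> basis_vec i \<in> X"
  by (erule absolutely_summable_mem_c0_or_lp, rule summable_finite[of "{i}"])
    (auto simp: basis_vec_def)

lemma tail_norm_tendsto_0:
  assumes "c0_or_lp X N" "x \<in> X"
  shows "(\<lambda>m. N (\<lambda>i. if i < m then 0 else x i)) \<longlonglongrightarrow> 0"
proof -
  define tail where "tail m = (\<lambda>i. if i < m then 0 else x i)" for m
  have tail_mem: "tail m \<in> X" for m
    using c0_or_lp_dominated(1)[OF assms(1) _ assms(2), of 1 "tail m"] by (simp add: tail_def)
  have c0: "\<forall>\<^sub>F m in sequentially. c0_norm (tail m) \<le> e" if "x \<in> c0_space" "e > 0" for e
  proof -
    have "(\<lambda>n. norm (x n)) \<longlonglongrightarrow> 0"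
      using that(1) by (simp add: c0_space_def tendsto_norm_zero)
    then have "\<forall>\<^sub>F n in sequentially. norm (x n) < e"
      using that(2) by (rule order_tendstoD)
    then obtain M where M: "\<And>n. n \<ge> M \<Longrightarrow> norm (x n) < e"
      by (auto simp: eventually_sequentially)
    have "c0_norm (tail m) \<le> e" if "m \<ge> M" for m
      using M that \<open>e > 0\<close> by (intro c0_norm_least) (auto simp: tail_def intro!: less_imp_le)
    then show ?thesis by (auto simp: eventually_sequentially)
  qed
  have lp: "\<forall>\<^sub>F m in sequentially. lp_norm p (tail m) \<le> e"
    if p: "p \<ge> 1" and x: "x \<in> lp_space p" and e: "e > 0" for p e
  proof -
    have s: "summable (\<lambda>n. norm (x n) powr p)" using x by (simp add: lp_space_def)
    obtain M where M: "\<And>m. m \<ge> M \<Longrightarrow> norm (\<Sum>i. norm (x (i + m)) powr p) < e powr p"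
      using suminf_exist_split[of "e powr p", OF _ s] e by auto
    have "lp_norm p (tail m) \<le> e" if m: "m \<ge> M" for m
    proof (rule lp_norm_le[OF p])
      show t: "tail m \<in> lp_space p"
        using lp_dominated(1)[OF p _ x, of 1 "tail m"] by (simp add: tail_def)
      then have "summable (\<lambda>i. norm (tail m i) powr p)" by (simp add: lp_space_def)
      from suminf_split_initial_segment[OF this, of m]
      have "(\<Sum>i. norm (tail m i) powr p) = (\<Sum>i. norm (x (i + m)) powr p)"
        by (simp add: tail_def)
      then show "(\<Sum>i. norm (tail m i) powr p) \<le> e powr p" using M[OF m] by simp
    qed (use e in simp)
    then show ?thesis by (auto simp: eventually_sequentially)
  qed
  have "x \<in> X \<longrightarrow> (\<forall>e>0. \<forall>\<^sub>F m in sequentially. N (tail m) \<le> e)"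
    using assms(1) by (rule c0_or_lp_cases) (use c0 lp in blast)+
  then have small: "\<forall>\<^sub>F m in sequentially. N (tail m) \<le> e" if "e > 0" for e
    using assms(2) that by blast
  have "(\<lambda>m. N (tail m)) \<longlonglongrightarrow> 0"
  proof (rule tendstoI)
    fix e :: real assume "e > 0"
    then show "\<forall>\<^sub>F m in sequentially. dist (N (tail m)) 0 < e"
      using small[of "e / 2"] c0_or_lp_eq_0(1)[OF assms(1) tail_mem]
      by (auto elim!: eventually_mono)
  qed
  then show ?thesis by (simp add: tail_def)
qed

lemma shift_right_by:
  assumes "c0_or_lp X N" "x \<in> X"
  shows "(\<lambda>i. if i < m then 0 else x (i - m)) \<in> X \<and> N (\<lambda>i. if i < m then 0 else x (i - m)) \<le> N x"
proof (induction m)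
  case 0
  then show ?case using assms by simp
next
  case (Suc m)
  let ?y = "\<lambda>m i. if i < m then 0 else x (i - m)"
  have eq: "?y (Suc m) = case_nat 0 (?y m)"
    by (auto simp: fun_eq_iff split: nat.split)
  show ?case
    unfolding eq using Suc shift_right[OF assms(1), of "?y m"] by (meson order_trans)
qed

lemma limitin_zero_iff:
  assumes "c0_or_lp X N"
  shows "limitin (norm_topology X N) f (\<lambda>_. 0) sequentially \<longleftrightarrow>
    (\<forall>e>0. \<forall>\<^sub>F k in sequentially. f k \<in> X \<and> N (f k) < e)"
proof -
  interpret Metric_space X "norm_dist X N" by (rule c0_or_lp_metric[OF assms])
  have "f k \<in> X \<and> norm_dist X N (f k) (\<lambda>_. 0) < e \<longleftrightarrow> f k \<in> X \<and> N (f k) < e" for k e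
    using zero_mem_c0_or_lp[OF assms] by (auto simp: norm_dist_def)
  then show ?thesis
    unfolding norm_topology_def limitin_metric using zero_mem_c0_or_lp[OF assms] by simp
qed

text \<open>
  A gliding hump in place of the Banach--Steinhaus theorem: if \<open>f\<close> were unbounded above, it
  would exceed \<open>4\<^sup>j\<close> at indices \<open>r\<^sub>0 < r\<^sub>1 < \<dots>\<close>. The absolutely convergent series \<open>\<Sum>\<^sub>j 2\<^bsup>-j\<^esup> e\<^bsub>r\<^sub>j\<^esub>\<close> then defines an element
  of \<open>X\<close> that \<open>f\<close> multiplies to an unbounded sequence.
\<close>

lemma bounded_multiplier:
  fixes f :: "nat \<Rightarrow> real"
  assumes X: "c0_or_lp X N"
    and bdd: "\<And>x. x \<in> X \<Longrightarrow> \<exists>C. \<forall>i. norm (x i) * f i \<le> C"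
  obtains C where "\<And>i. f i \<le> C"
proof (rule ccontr)
  assume "\<not> thesis"
  then have unb: "\<exists>i. f i > C" for C using that by (meson not_le)
  have large: "\<exists>i>m. f i > C" for m C
  proof -
    obtain i where i: "f i > Max (insert C (f ` {..m}))" using unb by blast
    then have *: "f i > C" "\<And>j. j \<le> m \<Longrightarrow> f i > f j" by auto
    have "i > m" using *(2)[of i] by (meson less_irrefl not_le)
    then show ?thesis using *(1) by blast
  qed
  have "\<exists>r. \<forall>j. f (r j) > 4 ^ j \<and> r j < r (Suc j)"
  proof (rule dependent_nat_choice)
    show "\<exists>i. f i > 4 ^ 0" using unb by blast
    show "\<exists>i'. f i' > 4 ^ Suc j \<and> i < i'" for i j using large by blast
  qed
  then obtain r where r: "\<And>j. f (r j) > 4 ^ j" and "strict_mono r"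
    by (auto simp: strict_mono_Suc_iff)
  define x :: "nat \<Rightarrow> complex"
    where "x i = (if i \<in> range r then of_real ((1 / 2) ^ inv r i) else 0)" for i
  have xr: "norm (x (r j)) = (1 / 2) ^ j" for j
    using strict_mono_imp_inj_on[OF \<open>strict_mono r\<close>]
    by (simp add: x_def inv_f_f norm_power norm_divide)
  have "summable (\<lambda>j. norm (x (r j)))" by (simp add: xr)
  then have "summable (\<lambda>i. norm (x i))"
    by (subst (asm) summable_mono_reindex[OF \<open>strict_mono r\<close>]) (simp_all add: x_def)
  then obtain C where C: "\<And>i. norm (x i) * f i \<le> C"
    using bdd absolutely_summable_mem_c0_or_lp[OF X] by blast
  have "2 ^ j \<le> C" for j
  proof -
    have "(2 :: real) ^ j = (1 / 2) ^ j * 4 ^ j"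
      by (simp flip: power_mult_distrib)
    also have "\<dots> \<le> norm (x (r j)) * f (r j)"
      unfolding xr using r[of j] by (intro mult_left_mono) auto
    finally show ?thesis using C[of "r j"] by linarith
  qed
  then show False using real_arch_pow[of 2 C] by (simp add: not_less[symmetric])
qed

section \<open>Powers of the shifts\<close>

lemma weight_prod_add: "weight_prod w i (j + k) = weight_prod w i j * weight_prod w (i + j) k"
  unfolding weight_prod_def add.assoc[symmetric] by (rule prod.atLeastLessThan_concat[symmetric]) auto

lemma weight_prod_1: "weight_prod w i (Suc 0) = w i"
  by (simp add: weight_prod_def)

lemma weight_prod_Suc: "weight_prod w i (Suc j) = weight_prod w i j * w (i + j)"
  using weight_prod_add[of w i j "Suc 0"] by (simp add: weight_prod_1)

lemma backward_shift_power:
  "(backward_shift w ^^ m) x = (\<lambda>i. of_real (weight_prod w (Suc i) m) * x (i + m))"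
proof (induction m arbitrary: x)
  case 0
  then show ?case by (simp add: weight_prod_def)
next
  case (Suc m)
  show ?case
    unfolding funpow_Suc_right o_def Suc
    by (simp add: backward_shift_def weight_prod_Suc fun_eq_iff)
qed

lemma forward_shift_power:
  "(forward_shift w ^^ m) x =
    (\<lambda>i. if i < m then 0 else x (i - m) / of_real (weight_prod w (Suc (i - m)) m))"
proof (induction m)
  case 0
  then show ?case by (simp add: weight_prod_def)
next
  case (Suc m)
  show ?case
    unfolding funpow.simps o_def Suc
    by (auto simp: forward_shift_def weight_prod_Suc fun_eq_iff split: nat.split)
qed

section \<open>The equivalences\<close>

locale weighted_shift =
  fixes X :: "(nat \<Rightarrow> complex) set" and N :: "(nat \<Rightarrow> complex) \<Rightarrow> real" and w :: "nat \<Rightarrow> real"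
  assumes space: "c0_or_lp X N"
    and w_pos: "\<And>i. i \<ge> 1 \<Longrightarrow> w i > 0"
    and w_bounded: "bounded (w ` {1..})"
begin

sublocale Metric_space X "norm_dist X N"
  by (rule c0_or_lp_metric[OF space])

abbreviation B where "B \<equiv> backward_shift w"
abbreviation S where "S \<equiv> forward_shift w"
abbreviation M where "M \<equiv> weight_prod w"

lemma weight_prod_pos: "i \<ge> 1 \<Longrightarrow> M i j > 0"
  unfolding weight_prod_def by (intro prod_pos) (auto intro: w_pos)

lemma backward_shift_continuous: "continuous_linear_operator X N B"
  using backward_shift_continuous_linear[OF space w_pos w_bounded] .

lemma backward_shift_mem: "x \<in> X \<Longrightarrow> B x \<in> X"
  using backward_shift_continuous
  by (auto simp: continuous_linear_operator_def norm_topology_def continuous_map_def)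

lemma backward_shift_power_mem: "x \<in> X \<Longrightarrow> (B ^^ m) x \<in> X"
  by (induction m) (auto intro: backward_shift_mem)

text \<open>
  \<open>B\<^sub>w\<^sup>m u = x\<close> determines the coordinates of \<open>u\<close> from \<open>m\<close> on; \<open>S\<^sup>m x\<close> has the same ones and zeros
  before them, hence is dominated by \<open>u\<close> coordinatewise.
\<close>

lemma forward_shift_power_le_preimage:
  assumes "u \<in> X" "(B ^^ m) u = x"
  shows "(S ^^ m) x \<in> X" "N ((S ^^ m) x) \<le> N u"
proof -
  have "norm ((S ^^ m) x i) \<le> 1 * norm (u i)" for i
    using weight_prod_pos[of "Suc (i - m)" m] assms(2)
    by (auto simp: forward_shift_power backward_shift_power)
  from c0_or_lp_dominated[OF space _ assms(1) this]
  show "(S ^^ m) x \<in> X" "N ((S ^^ m) x) \<le> N u" by auto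
qed

text \<open>
  If \<open>B\<^sub>w\<close> is surjective, \<open>S x\<close> lies in \<open>X\<close> for every \<open>x\<close>, so multiplication by \<open>1 / w\<^bsub>i+1\<^esub>\<close>
  keeps every element of \<open>X\<close> bounded. Conversely, weights bounded away from 0
  make \<open>S\<close> an operator on \<open>X\<close>, and it is a right inverse of \<open>B\<^sub>w\<close>.
\<close>

lemma surjective_iff_inf_weights_pos: "B ` X = X \<longleftrightarrow> (INF i\<in>{1..}. w i) > 0"
proof
  assume surj: "B ` X = X"
  have "\<exists>C. \<forall>i. norm (x i) * (1 / w (Suc i)) \<le> C" if x: "x \<in> X" for x
  proof -
    have "x \<in> B ` X" unfolding surj by (rule x)
    then obtain u where "u \<in> X" "B u = x" by blast
    then have "S x \<in> X" using forward_shift_power_le_preimage(1)[of u 1 x] by simp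
    then have "norm (S x (Suc i)) \<le> N (S x)" for i by (rule coordinate_le_norm[OF space])
    moreover have "norm (S x (Suc i)) = norm (x i) * (1 / w (Suc i))" for i
      using w_pos[of "Suc i"] by (simp add: forward_shift_def norm_divide)
    ultimately show ?thesis by auto
  qed
  from bounded_multiplier[OF space this]
  obtain C where C: "\<And>i. 1 / w (Suc i) \<le> C" by blast
  have "0 < 1 / w (Suc 0)" using w_pos[of "Suc 0"] by simp
  then have "C > 0" using C[of 0] by linarith
  have "1 / C \<le> w i" if "i \<ge> 1" for i
    using C[of "i - 1"] w_pos[OF that] \<open>C > 0\<close> that by (simp add: field_simps)
  then have "1 / C \<le> (INF i\<in>{1..}. w i)" by (intro cINF_greatest) auto
  then show "(INF i\<in>{1..}. w i) > 0"
    using \<open>C > 0\<close> by (meson less_le_trans zero_less_divide_1_iff)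
next
  assume "(INF i\<in>{1..}. w i) > 0"
  from forward_shift_continuous_linear[OF space w_pos this]
  have "S x \<in> X" if "x \<in> X" for x
    using that by (auto simp: continuous_linear_operator_def norm_topology_def continuous_map_def)
  then have "x \<in> B ` X" if "x \<in> X" for x
    using that by (intro image_eqI[of x B "S x"] backward_forward_shift[OF w_pos, symmetric])
  then show "B ` X = X" by (intro equalityI subsetI) (auto intro: backward_shift_mem)
qed

lemma weight_prod_ge_power:
  assumes "(INF i\<in>{1..}. w i) > 0" "i \<ge> 1"
  shows "(INF i\<in>{1..}. w i) ^ j \<le> M i j"
proof (induction j)
  case 0
  then show ?case by (simp add: weight_prod_def)
next
  case (Suc j)
  have "bdd_below (w ` {1..})" using w_pos by (intro bdd_belowI2[of _ 0]) (simp add: less_imp_le)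
  then have "(INF i\<in>{1..}. w i) \<le> w (i + j)" using assms(2) by (intro cINF_lower) auto
  then have "(INF i\<in>{1..}. w i) ^ j * (INF i\<in>{1..}. w i) \<le> M i j * w (i + j)"
    using Suc assms weight_prod_pos[OF assms(2), of j] by (intro mult_mono) auto
  then show ?case by (simp add: weight_prod_Suc mult.commute)
qed

text \<open>
  One weight product tending to infinity suffices, because windows of the same length \<open>n k\<close>
  starting at 1 and at \<open>i + 1\<close> differ only by \<open>i\<close> weights at each end.
\<close>

lemma weight_prod_at_top_shift:
  assumes inf: "(INF i\<in>{1..}. w i) > 0"
    and lim: "filterlim (\<lambda>k. M 1 (n k)) at_top F"
  shows "filterlim (\<lambda>k. M (Suc i) (n k)) at_top F"
proof (rule filterlim_at_top_mono)
  let ?c = "(INF i\<in>{1..}. w i) ^ i / M 1 i"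
  have c: "?c > 0" using inf weight_prod_pos[of 1 i] by simp
  show "filterlim (\<lambda>k. ?c * M 1 (n k)) at_top F"
    by (rule filterlim_tendsto_pos_mult_at_top[OF tendsto_const c lim])
  have "?c * M 1 m \<le> M (Suc i) m" for m
  proof -
    have "M 1 i * M (Suc i) m = M 1 m * M (Suc m) i"
      using weight_prod_add[of w 1 i m] weight_prod_add[of w 1 m i] by (simp add: add.commute)
    moreover have "M 1 m * (INF i\<in>{1..}. w i) ^ i \<le> M 1 m * M (Suc m) i"
      using weight_prod_ge_power[OF inf, of "Suc m" i] weight_prod_pos[of 1 m]
      by (intro mult_left_mono) auto
    ultimately show ?thesis
      using weight_prod_pos[of 1 i] by (simp add: field_simps)
  qed
  then show "\<forall>\<^sub>F k in F. ?c * M 1 (n k) \<le> M (Suc i) (n k)" by simp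
qed

text \<open>
  Small balls around 0 give one direction. For the other, a point \<open>u\<close> of \<open>U\<close> is moved to a preimage
  of \<open>x\<close> by replacing its coordinates from \<open>n k\<close> on by those of \<open>S\<^bsup>n k\<^esup> x\<close>, a small change
  since \<open>n k \<rightarrow> \<infinity>\<close>.
\<close>

lemma ultra_hypercyclic_iff:
  assumes n: "filterlim n at_top sequentially"
  shows "ultra_hypercyclic X N B n \<longleftrightarrow>
    (\<forall>x\<in>X. limitin (norm_topology X N) (\<lambda>k. (S ^^ n k) x) (\<lambda>_. 0) sequentially)"
    (is "?uh \<longleftrightarrow> ?lim")
proof
  assume uh: ?uh
  show ?lim
    unfolding limitin_zero_iff[OF space]
  proof (intro ballI allI impI)
    fix x and e :: real assume x: "x \<in> X" and e: "e > 0"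
    let ?U = "mball (\<lambda>_. 0) e"
    have "openin (norm_topology X N) ?U" "?U \<noteq> {}"
      using zero_mem_c0_or_lp[OF space] e by (auto simp: norm_topology_def)
    then have "X = (\<Union>i\<in>{1..}. \<Inter>k\<in>{i..}. (B ^^ n k) ` ?U)"
      using uh unfolding ultra_hypercyclic_def by blast
    with x have "x \<in> (\<Union>i\<in>{1..}. \<Inter>k\<in>{i..}. (B ^^ n k) ` ?U)" by simp
    then obtain i where i: "\<And>k. k \<ge> i \<Longrightarrow> x \<in> (B ^^ n k) ` ?U" by auto
    have "(S ^^ n k) x \<in> X \<and> N ((S ^^ n k) x) < e" if k: "k \<ge> i" for k
    proof -
      obtain u where u: "u \<in> ?U" "(B ^^ n k) u = x" using i[OF k] by auto
      then have "u \<in> X" "N u < e"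
        using commute[of u "\<lambda>_. 0"] by (auto simp: norm_dist_def)
      then show ?thesis using forward_shift_power_le_preimage[OF _ u(2)] by force
    qed
    then show "\<forall>\<^sub>F k in sequentially. (S ^^ n k) x \<in> X \<and> N ((S ^^ n k) x) < e"
      by (auto simp: eventually_sequentially)
  qed
next
  assume lim: ?lim
  have "X = (\<Union>i\<in>{1..}. \<Inter>k\<in>{i..}. (B ^^ n k) ` U)"
    if U: "openin (norm_topology X N) U" "U \<noteq> {}" for U
  proof (intro equalityI subsetI)
    fix x assume x: "x \<in> X"
    obtain u where u: "u \<in> U" using U by auto
    obtain e where e: "e > 0" "mball u e \<subseteq> U" and UX: "U \<subseteq> X"
      using U(1) u unfolding norm_topology_def openin_mtopology by blast
    have uX: "u \<in> X" using u UX by auto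
    define tail where "tail m = (\<lambda>i. if i < m then 0 else u i)" for m
    have "(\<lambda>k. N (tail (n k))) \<longlonglongrightarrow> 0"
      unfolding tail_def by (rule filterlim_compose[OF tail_norm_tendsto_0[OF space uX] n])
    then have "\<forall>\<^sub>F k in sequentially. N (tail (n k)) < e / 2"
      using e by (intro order_tendstoD) auto
    moreover have "\<forall>\<^sub>F k in sequentially. (S ^^ n k) x \<in> X \<and> N ((S ^^ n k) x) < e / 2"
      
      by (rule lim[unfolded limitin_zero_iff[OF space], rule_format, OF x half_gt_zero[OF e(1)]])
    ultimately have "\<forall>\<^sub>F k in sequentially. x \<in> (B ^^ n k) ` U"
    proof eventually_elim
      case (elim k)
      define s where "s = (S ^^ n k) x"
      \<comment> \<open>\<open>y\<close> is still a preimage of \<open>x\<close>, and \<open>u - y\<close> is a tail of \<open>u\<close> minus \<open>S\<^bsup>n k\<^esup> x\<close>.\<close>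
      define y where "y i = (if i < n k then u i else s i)" for i
      have sX: "s \<in> X" and s: "N s < e / 2" using elim(2) by (auto simp: s_def)
      have tX: "tail (n k) \<in> X"
        using c0_or_lp_dominated(1)[OF space _ uX, of 1 "tail (n k)"] by (simp add: tail_def)
      have "norm (- s i) \<le> 1 * norm (s i)" for i by simp
      from c0_or_lp_dominated[OF space _ sX this]
      have ms: "(\<lambda>i. - s i) \<in> X" "N (\<lambda>i. - s i) \<le> N s" by auto
      have diff: "(\<lambda>i. u i - y i) = (\<lambda>i. tail (n k) i + - s i)"
        by (auto simp: y_def tail_def s_def forward_shift_power fun_eq_iff)
      have "(\<lambda>i. u i - y i) \<in> X"
        unfolding diff by (rule c0_or_lp_triangle(1)[OF space tX ms(1)])
      from c0_or_lp_diff[OF space uX this] have yX: "y \<in> X" by simp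
      have "N (\<lambda>i. u i - y i) < e"
        unfolding diff using c0_or_lp_triangle(2)[OF space tX ms(1)] ms(2) s elim(1) by linarith
      then have "y \<in> U" using e(2) uX yX by (auto simp: norm_dist_def)
      moreover have "(B ^^ n k) y = x"
      proof
        show "(B ^^ n k) y i = x i" for i
          using weight_prod_pos[of "Suc i" "n k"]
          by (simp add: backward_shift_power y_def s_def forward_shift_power)
      qed
      ultimately show ?case by blast
    qed
    then obtain i where "\<And>k. k \<ge> i \<Longrightarrow> x \<in> (B ^^ n k) ` U"
      by (auto simp: eventually_sequentially)
    then show "x \<in> (\<Union>i\<in>{1..}. \<Inter>k\<in>{i..}. (B ^^ n k) ` U)"
      by (intro UN_I[of "max i 1"]) auto
  next
    fix x assume "x \<in> (\<Union>i\<in>{1..}. \<Inter>k\<in>{i..}. (B ^^ n k) ` U)"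
    then obtain i where "x \<in> (B ^^ n i) ` U" by (meson INT_E UN_E atLeast_iff order_refl)
    then obtain m u where "u \<in> U" "x = (B ^^ m) u" by blast
    then show "x \<in> X"
      using U(1) backward_shift_power_mem
      unfolding norm_topology_def openin_mtopology by blast
  qed
  then show ?uh unfolding ultra_hypercyclic_def using backward_shift_continuous by blast
qed

text \<open>
  The vector \<open>e\<^sub>0\<close> gives the limit of \<open>M\<^sub>1\<^bsup>n k\<^esup>\<close>. For the uniform bound, the convergent
  sequence of norms of \<open>S\<^bsup>n k\<^esup> x\<close> is bounded and dominates \<open>\<bar>x\<^sub>i\<bar> / M\<^bsub>i+1\<^esub>\<^bsup>n k\<^esup>\<close>,
  so \<open>bounded_multiplier\<close> applies once the supremum over \<open>k\<close> is taken.
\<close>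

lemma weight_prods_if_powers_tendsto_0:
  assumes lim: "\<forall>x\<in>X. limitin (norm_topology X N) (\<lambda>k. (S ^^ n k) x) (\<lambda>_. 0) sequentially"
    and surj: "B ` X = X"
  shows "filterlim (\<lambda>k. M 1 (n k)) at_top sequentially"
    and "(INF (i, k)\<in>{1..} \<times> {1..}. M i (n k)) > 0"
proof -
  have mem: "(S ^^ m) x \<in> X" if "x \<in> X" for x m
  proof -
    have "(B ^^ m) ` X = X"
      
    proof (induction m)
      case (Suc m)
      have "(B ^^ Suc m) ` X = B ` ((B ^^ m) ` X)" by (simp add: image_image)
      then show ?case using Suc surj by simp
    qed simp
    then have "x \<in> (B ^^ m) ` X" using that by simp
    then obtain u where "u \<in> X" "(B ^^ m) u = x" by blast
    then show ?thesis by (rule forward_shift_power_le_preimage(1))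
  qed
  have coord: "norm (x i) / M (Suc i) m \<le> N ((S ^^ m) x)" if "x \<in> X" for x i m
    using coordinate_le_norm[OF space mem[OF that], of m "i + m"] weight_prod_pos[of "Suc i" m]
    by (simp add: forward_shift_power norm_divide)
  have norm_lim: "(\<lambda>k. N ((S ^^ n k) x)) \<longlonglongrightarrow> 0" if x: "x \<in> X" for x
  proof (rule tendstoI)
    fix e :: real assume "e > 0"
    from lim[unfolded limitin_zero_iff[OF space], rule_format, OF x this]
    have "\<forall>\<^sub>F k in sequentially. N ((S ^^ n k) x) < e" by (rule eventually_mono) simp
    then show "\<forall>\<^sub>F k in sequentially. dist (N ((S ^^ n k) x)) 0 < e"
      using c0_or_lp_eq_0(1)[OF space mem[OF x]] by (simp add: dist_norm)
  qed

  have "(\<lambda>k. inverse (M 1 (n k))) \<longlonglongrightarrow> 0"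
  proof (rule tendsto_sandwich[OF _ _ tendsto_const norm_lim[OF basis_vec_mem_c0_or_lp[OF space, of 0]]])
    show "\<forall>\<^sub>F k in sequentially. 0 \<le> inverse (M 1 (n k))"
      using weight_prod_pos[of 1] by (simp add: less_imp_le)
    show "\<forall>\<^sub>F k in sequentially. inverse (M 1 (n k)) \<le> N ((S ^^ n k) (basis_vec 0))"
      using coord[OF basis_vec_mem_c0_or_lp[OF space, of 0], of 0]
      by (simp add: basis_vec_def inverse_eq_divide)
  qed
  from filterlim_inverse_at_top[OF this]
  show "filterlim (\<lambda>k. M 1 (n k)) at_top sequentially"
    using weight_prod_pos[of 1] by simp

  have bdd: "\<exists>C. \<forall>i k. norm (x i) * (1 / M (Suc i) (n k)) \<le> C" if x: "x \<in> X" for x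
  proof -
    from convergent_imp_Bseq[OF convergentI[OF norm_lim[OF x]]]
    obtain C where C: "\<And>k. norm (N ((S ^^ n k) x)) \<le> C" by (auto simp: Bseq_def)
    have "norm (x i) * (1 / M (Suc i) (n k)) \<le> C" for i k
      using coord[OF x, of i "n k"] C[of k] by simp
    then show ?thesis by blast
  qed
  \<comment> \<open>The supremum is finite by the bound for \<open>e\<^sub>i\<close>.\<close>
  define f where "f i = (SUP k. 1 / M (Suc i) (n k))" for i
  have f_bdd: "bdd_above (range (\<lambda>k. 1 / M (Suc i) (n k)))" for i
  proof -
    obtain C where "\<And>j k. norm (basis_vec i j) * (1 / M (Suc j) (n k)) \<le> C"
      using bdd[OF basis_vec_mem_c0_or_lp[OF space]] by blast
    from this[of i] show ?thesis by (intro bdd_aboveI2[of _ _ C]) (simp add: basis_vec_def)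
  qed
  then have f_upper: "1 / M (Suc i) (n k) \<le> f i" for i k
    unfolding f_def by (rule cSUP_upper[OF UNIV_I])
  have "\<exists>C. \<forall>i. norm (x i) * f i \<le> C" if x: "x \<in> X" for x
  proof -
    obtain C where C: "\<And>i k. norm (x i) * (1 / M (Suc i) (n k)) \<le> C" using bdd[OF x] by blast
    have "norm (x i) * f i \<le> max C 0" for i
    proof (cases "x i = 0")
      case False
      have "f i \<le> C / norm (x i)"
        unfolding f_def using C[of i] False by (intro cSUP_least) (auto simp: field_simps)
      then show ?thesis using False by (simp add: field_simps)
    qed simp
    then show ?thesis by blast
  qed
  from bounded_multiplier[OF space this] obtain C where C: "\<And>i. f i \<le> C" by blast
  have inv_le: "1 / M (Suc i) (n k) \<le> C" for i k
    by (rule order_trans[OF f_upper C])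
  have "0 < 1 / M (Suc 0) (n 0)" using weight_prod_pos[of "Suc 0" "n 0"] by simp
  then have "C > 0" using inv_le[of 0 0] by linarith
  have "1 / C \<le> M i (n k)" if "i \<ge> 1" for i k
    using inv_le[of "i - 1" k] weight_prod_pos[OF that, of "n k"] \<open>C > 0\<close> that
    by (simp add: field_simps)
  then have "1 / C \<le> (INF (i, k)\<in>{1..} \<times> {1..}. M i (n k))" by (intro cINF_greatest) auto
  then show "(INF (i, k)\<in>{1..} \<times> {1..}. M i (n k)) > 0"
    using \<open>C > 0\<close> by (meson less_le_trans zero_less_divide_1_iff)
qed

text \<open>
  The powers \<open>S\<^bsup>n k\<^esup>\<close> are uniformly bounded, so the tail of \<open>x\<close> contributes little for every \<open>k\<close>;
  the remaining coordinates are finitely many, and \<open>S\<^bsup>n k\<^esup>\<close> scales each by a factor tending to 0.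
\<close>

lemma powers_tendsto_0_if_weight_prods:
  assumes inf: "(INF i\<in>{1..}. w i) > 0"
    and lim: "filterlim (\<lambda>k. M 1 (n k)) at_top sequentially"
    and unif: "(INF (i, k)\<in>{1..} \<times> {1..}. M i (n k)) > 0"
    and x: "x \<in> X"
  shows "limitin (norm_topology X N) (\<lambda>k. (S ^^ n k) x) (\<lambda>_. 0) sequentially"
  unfolding limitin_zero_iff[OF space]
proof (intro allI impI)
  fix e :: real assume e: "e > 0"
  define d where "d = (INF (i, k)\<in>{1..} \<times> {1..}. M i (n k))"
  have d: "d > 0" using unif by (simp add: d_def)
  have "bdd_below ((\<lambda>(i, k). M i (n k)) ` ({1..} \<times> {1..}))"
    using weight_prod_pos by (intro bdd_belowI2[of _ 0]) (auto simp: less_imp_le)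
  then have d_le: "d \<le> M i (n k)" if "i \<ge> 1" "k \<ge> 1" for i k
    unfolding d_def using that cINF_lower[of "\<lambda>(i, k). M i (n k)" "{1..} \<times> {1..}" "(i, k)"] by auto

  \<comment> \<open>Coordinatewise bounds on \<open>S\<^sup>m\<close> give norm bounds, since right shifts are contractions.\<close>
  have power_bound: "(S ^^ m) z \<in> X \<and> N ((S ^^ m) z) \<le> C * N z"
    if z: "z \<in> X" and C: "C \<ge> 0" and le: "\<And>i. norm (z i) / M (Suc i) m \<le> C * norm (z i)" for z m C
  proof -
    let ?z = "\<lambda>i. if i < m then 0 else z (i - m)"
    have "norm ((S ^^ m) z i) \<le> C * norm (?z i)" for i
      using le[of "i - m"] weight_prod_pos[of "Suc (i - m)" m]
      by (simp add: forward_shift_power norm_divide)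
    from c0_or_lp_dominated[OF space C conjunct1[OF shift_right_by[OF space z]] this]
    have "(S ^^ m) z \<in> X" "N ((S ^^ m) z) \<le> C * N ?z" .
    then show ?thesis
      using mult_left_mono[OF conjunct2[OF shift_right_by[OF space z, of m]] C] by linarith
  qed

  have "(\<lambda>m. N (\<lambda>i. if i < m then 0 else x i)) \<longlonglongrightarrow> 0"
    by (rule tail_norm_tendsto_0[OF space x])
  then have "\<forall>\<^sub>F m in sequentially. N (\<lambda>i. if i < m then 0 else x i) < d * e / 2"
    using d e by (intro order_tendstoD) auto
  then obtain m where m: "N (\<lambda>i. if i < m then 0 else x i) < d * e / 2"
    by (auto simp: eventually_sequentially)
  define t where "t i = (if i < m then 0 else x i)" for i
  define h where "h i = (if i < m then x i else 0)" for i
  have "norm (t i) \<le> 1 * norm (x i)" "norm (h i) \<le> 1 * norm (x i)" for i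
    by (auto simp: t_def h_def)
  then have tX: "t \<in> X" and hX: "h \<in> X"
    using c0_or_lp_dominated(1)[OF space _ x, of 1] by auto

  define c where "c k = (\<Sum>i<m. 1 / M (Suc i) (n k))" for k
  have "(\<lambda>k. 1 / M (Suc i) (n k)) \<longlonglongrightarrow> 0" for i
    using weight_prod_at_top_shift[OF inf lim] by (rule tendsto_divide_0[OF tendsto_const filterlim_at_top_imp_at_infinity])
  then have "c \<longlonglongrightarrow> (\<Sum>i<m. 0)" unfolding c_def by (intro tendsto_sum)
  then have "(\<lambda>k. c k * N h) \<longlonglongrightarrow> 0" by (simp add: tendsto_mult_left_zero)
  then have "\<forall>\<^sub>F k in sequentially. c k * N h < e / 2" using e by (intro order_tendstoD) auto
  then show "\<forall>\<^sub>F k in sequentially. (S ^^ n k) x \<in> X \<and> N ((S ^^ n k) x) < e"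
    using eventually_ge_at_top[of 1]
  proof eventually_elim
    case (elim k)
    have c_ge: "1 / M (Suc i) (n k) \<le> c k" if "i < m" for i
      unfolding c_def using that weight_prod_pos
      by (intro member_le_sum[of i "{..<m}" "\<lambda>i. 1 / M (Suc i) (n k)"]) (auto simp: less_imp_le)
    have "c k \<ge> 0"
      unfolding c_def using weight_prod_pos by (intro sum_nonneg) (auto simp: less_imp_le)
    moreover have "norm (h i) / M (Suc i) (n k) \<le> c k * norm (h i)" for i
      using mult_right_mono[OF c_ge, of i "norm (x i)"] by (simp add: h_def)
    ultimately have head: "(S ^^ n k) h \<in> X" "N ((S ^^ n k) h) \<le> c k * N h"
      using power_bound[OF hX] by auto
    have "norm (t i) / M (Suc i) (n k) \<le> 1 / d * norm (t i)" for i
      using divide_left_mono[OF d_le[of "Suc i" k], of "norm (t i)"] elim(2) d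
        weight_prod_pos[of "Suc i" "n k"] by simp
    from power_bound[OF tX _ this]
    have tail: "(S ^^ n k) t \<in> X" "N ((S ^^ n k) t) \<le> 1 / d * N t" using d by auto
    have eq: "(S ^^ n k) x = (\<lambda>i. (S ^^ n k) h i + (S ^^ n k) t i)"
      by (auto simp: forward_shift_power h_def t_def fun_eq_iff)
    have "1 / d * N t < e / 2" using m d by (simp add: t_def[abs_def] field_simps)
    then show ?case
      unfolding eq using c0_or_lp_triangle[OF space head(1) tail(1)] head(2) tail(2) elim(1)
      by linarith
  qed
qed

end

theorem theorem2p6:
  fixes X :: "(nat \<Rightarrow> complex) set" and N :: "(nat \<Rightarrow> complex) \<Rightarrow> real"
    and w :: "nat \<Rightarrow> real" and n :: "nat \<Rightarrow> nat"
  assumes space: "c0_or_lp X N"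
    and w_pos: "\<forall>i\<ge>1. w i > 0"
    and w_bounded: "bounded (w ` {1..})"
    and n_pos: "\<forall>k\<ge>1. n k > 0"
    and n_increasing: "strict_mono_on {1..} n"
  shows "(backward_shift w ` X = X \<and> ultra_hypercyclic X N (backward_shift w) n \<longleftrightarrow>
          backward_shift w ` X = X \<and>
            (\<forall>x\<in>X. x \<noteq> (\<lambda>_. 0) \<longrightarrow>
              limitin (norm_topology X N) (\<lambda>k. (forward_shift w ^^ n k) x) (\<lambda>_. 0) sequentially))
       \<and> (backward_shift w ` X = X \<and>
            (\<forall>x\<in>X. x \<noteq> (\<lambda>_. 0) \<longrightarrow>
              limitin (norm_topology X N) (\<lambda>k. (forward_shift w ^^ n k) x) (\<lambda>_. 0) sequentially)
          \<longleftrightarrow>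
          (INF i\<in>{1..}. w i) > 0 \<and>
            filterlim (\<lambda>k. weight_prod w 1 (n k)) at_top sequentially \<and>
            (INF (i, k)\<in>{1..} \<times> {1..}. weight_prod w i (n k)) > 0)"
proof -
  interpret weighted_shift X N w
    using space w_pos w_bounded by unfold_locales auto
  have "k \<le> n k" if "k \<ge> 1" for k
    using that
  proof (induction k rule: dec_induct)
    case base
    then show ?case using n_pos by (simp add: Suc_le_eq)
  next
    case (step k)
    then have "n k < n (Suc k)" using n_increasing by (auto simp: strict_mono_on_def)
    then show ?case using step by linarith
  qed
  then have "\<forall>\<^sub>F k in sequentially. k \<le> n k"
    by (auto simp: eventually_sequentially)
  then have n_lim: "filterlim n at_top sequentially"
    by (rule filterlim_at_top_mono[OF filterlim_ident])
  have zero: "(S ^^ m) (\<lambda>_. 0) = (\<lambda>_. 0)" for m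
    by (simp add: forward_shift_power fun_eq_iff)
  have "limitin (norm_topology X N) (\<lambda>k. (S ^^ n k) (\<lambda>_. 0)) (\<lambda>_. 0) sequentially"
    using zero_mem_c0_or_lp[OF space] by (simp add: zero norm_topology_def)
  then have nonzero: "(\<forall>x\<in>X. x \<noteq> (\<lambda>_. 0) \<longrightarrow>
        limitin (norm_topology X N) (\<lambda>k. (S ^^ n k) x) (\<lambda>_. 0) sequentially) \<longleftrightarrow>
      (\<forall>x\<in>X. limitin (norm_topology X N) (\<lambda>k. (S ^^ n k) x) (\<lambda>_. 0) sequentially)"
    by (intro ball_cong refl) auto
  show ?thesis
    unfolding nonzero ultra_hypercyclic_iff[OF n_lim]
  proof (intro conjI[OF refl] iffI)
    assume "B ` X = X \<and>
      (\<forall>x\<in>X. limitin (norm_topology X N) (\<lambda>k. (S ^^ n k) x) (\<lambda>_. 0) sequentially)"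
    then have "B ` X = X" and
      lim: "\<forall>x\<in>X. limitin (norm_topology X N) (\<lambda>k. (S ^^ n k) x) (\<lambda>_. 0) sequentially"
      by blast+
    then show "(INF i\<in>{1..}. w i) > 0 \<and>
        filterlim (\<lambda>k. weight_prod w 1 (n k)) at_top sequentially \<and>
        (INF (i, k)\<in>{1..} \<times> {1..}. weight_prod w i (n k)) > 0"
      by (intro conjI iffD1[OF surjective_iff_inf_weights_pos] weight_prods_if_powers_tendsto_0[OF lim])
  next
    assume "(INF i\<in>{1..}. w i) > 0 \<and>
        filterlim (\<lambda>k. weight_prod w 1 (n k)) at_top sequentially \<and>
        (INF (i, k)\<in>{1..} \<times> {1..}. weight_prod w i (n k)) > 0"
    then show "B ` X = X \<and>
      (\<forall>x\<in>X. limitin (norm_topology X N) (\<lambda>k. (S ^^ n k) x) (\<lambda>_. 0) sequentially)"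
      by (intro conjI ballI iffD2[OF surjective_iff_inf_weights_pos]
          powers_tendsto_0_if_weight_prods) (elim conjE; assumption)+
  qed
qed

end
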